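(* Consider the surface node placing algorithm described in the context, run with $N_s$ starting parameters and $n$ candidate directions per iteration, and suppose it terminates returning $N$ nodes. Let $P(N_s)$ be the cost of building the spatial search structure on $N_s$ points, let $Q(N)$ and $I(N)$ be the costs of one closest-point query and one insertion (upper bounds valid for structures containing at most $N$ points), let $e_1$ be the cost of evaluating $\boldsymbol r$ once and $e_2$ the cost of evaluating $\nabla\boldsymbol r$ once, and assume all other elementary operations have (amortized) constant cost. Then the total running time of the algorithm is $$O\big(P(N_s)+N(n+1)e_1+Ne_2+NnQ(N)+NI(N)\big).$$ In particular, if the spatial search structure is a $k$-d tree with $P(N_s)=O(N_s\log N_s)$, $Q(N)=O(\log N)$, $I(N)=O(\log N)$, and $e_1,e_2$ are constants, and $N_s=O(N)$, then the total running time is $O(nN\log N)$.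
   Context: Input of the algorithm: a parametric domain $\Xi\subseteq\mathbb{R}^{d_\Xi}$ given by its characteristic function; a parametrization $\boldsymbol r\colon\Xi\to\partial\Omega\subset\mathbb{R}^d$ and its Jacobian $\nabla\boldsymbol r$; a list $\mathcal X$ of $N_s$ starting parameters in $\Xi$; a nodal spacing function $h\colon\partial\Omega\to(0,\infty)$; the number $n$ of candidates generated per iteration. Dimensions $d,d_\Xi$ are fixed. Algorithm: 1. Build a spatial search structure $T$ on the points $\boldsymbol r(\mathcal X)$; set $i\leftarrow 0$. 2. While $i<|\mathcal X|$ (list indexed from $0$): (a) let $\boldsymbol\xi_i=\mathcal X[i]$, $\boldsymbol p_i=\boldsymbol r(\boldsymbol\xi_i)$, $h_i=h(\boldsymbol p_i)$, and evaluate $\nabla\boldsymbol r(\boldsymbol\xi_i)$ once (its value is stored and reused); (b) for each of $n$ unit vectors $\vec s_{i,j}\in\mathbb{R}^{d_\Xi}$ (a randomly rotated fixed set of directions): set $\boldsymbol\eta_{i,j}=\boldsymbol\xi_i+\frac{h_i}{\|\nabla\boldsymbol r(\boldsymbol\xi_i)\vec s_{i,j}\|}\vec s_{i,j}$; if $\boldsymbol\eta_{i,j}\in\Xi$, compute $\boldsymbol c_{i,j}=\boldsymbol r(\boldsymbol\eta_{i,j})$ and $\hat h_{i,j}=\|\boldsymbol c_{i,j}-\boldsymbol p_i\|$, and query $T$ for the point $\boldsymbol n_{i,j}$ in $T$ closest to $\boldsymbol c_{i,j}$; if $\|\boldsymbol c_{i,j}-\boldsymbol n_{i,j}\|\ge\hat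 h_{i,j}$, append $\boldsymbol\eta_{i,j}$ to the end of $\mathcal X$ and insert $\boldsymbol c_{i,j}$ into $T$; (c) set $i\leftarrow i+1$. 3. Return $\boldsymbol r(\mathcal X)$. $N$ denotes the number of returned nodes, i.e. the final length of $\mathcal X$ (so $N\ge N_s$). *)

theory Defs
  imports
    "HOL-Analysis.Analysis"
    "HOL-Library.Landau_Symbols"
    "HOL-Library.Multiset"
    "HOL-Library.While_Combinator"
begin

text \<open>
  The parametric domain lives in \<open>real ^ 'k\<close> and the surface in \<open>real ^ 'd\<close>, so the two dimensions are
  fixed by the types. The functions \<open>param\<close>, \<open>jac\<close> and \<open>spacing\<close> are total in HOL, but only their
  values on the parametric domain and on the boundary are constrained.
\<close>

record ('k, 'd) placing_input =
  domain_set :: "(real ^ 'k) set"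
  region :: "(real ^ 'd) set"
  param :: "real ^ 'k \<Rightarrow> real ^ 'd"
  jac :: "real ^ 'k \<Rightarrow> real ^ 'k ^ 'd"
  spacing :: "real ^ 'd \<Rightarrow> real"
  start_params :: "(real ^ 'k) list"
  base_dirs :: "(real ^ 'k) list"

definition valid_input :: "('k::finite, 'd::finite) placing_input \<Rightarrow> bool" where
  "valid_input A \<longleftrightarrow>
     param A ` domain_set A \<subseteq> frontier (region A) \<and>
     (\<forall>\<xi>\<in>domain_set A.
        (param A has_derivative (\<lambda>v. jac A \<xi> *v v)) (at \<xi> within domain_set A)) \<and>
     (\<forall>p\<in>frontier (region A). 0 < spacing A p) \<and>
     set (start_params A) \<subseteq> domain_set A \<and>
     (\<forall>s\<in>set (base_dirs A). norm s = 1)"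


text \<open>
  A spatial search structure with concrete states \<open>'t\<close>, specified through the multiset of
  stored points (starting points may coincide). Ties among closest points are resolved arbitrarily.
  The k-d trees are instances; the running time depends on them only through their cost bounds.
\<close>

record ('t, 'd) search_structure =
  ss_invar :: "'t \<Rightarrow> bool"
  ss_points :: "'t \<Rightarrow> (real ^ 'd) multiset"
  ss_build :: "(real ^ 'd) list \<Rightarrow> 't"
  ss_insert :: "real ^ 'd \<Rightarrow> 't \<Rightarrow> 't"
  ss_closest :: "'t \<Rightarrow> real ^ 'd \<Rightarrow> real ^ 'd"

definition valid_search_structure :: "('t, 'd::finite) search_structure \<Rightarrow> bool" where
  "valid_search_structure D \<longleftrightarrow>
     (\<forall>ps. ss_invar D (ss_build D ps) \<and> ss_points D (ss_build D ps) = mset ps) \<and>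
     (\<forall>T c. ss_invar D T \<longrightarrow>
        ss_invar D (ss_insert D c T) \<and>
        ss_points D (ss_insert D c T) = add_mset c (ss_points D T)) \<and>
     (\<forall>T c. ss_invar D T \<and> ss_points D T \<noteq> {#} \<longrightarrow>
        ss_closest D T c \<in># ss_points D T \<and>
        (\<forall>q\<in>#ss_points D T. norm (c - ss_closest D T c) \<le> norm (c - q)))"


text \<open>
  Executing the algorithm produces, besides its result, the chronological list of
  operations performed; the running time is the sum of their costs. Work in a fixed dimension
  (rotating a vector, a Jacobian-vector product, a norm) is a single elementary operation.
\<close>

datatype elementary =
    Initialize | Store | Loop_Test | Fetch | Eval_Spacing | Draw_Rotation | Rotate_Direction
  | Form_Candidate | Domain_Test | Compute_Distance | Compare | Append_Param | Increment | Return

datatype ('t, 'k, 'd) operation =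
    Eval_Param "real ^ 'k"
  | Eval_Jac "real ^ 'k"
  | Build "(real ^ 'd) list"
  | Query 't "real ^ 'd"
  | Insert "real ^ 'd" 't
  | is_elementary: Elementary elementary

record ('t, 'k, 'd) state =
  params :: "(real ^ 'k) list"
  tree :: 't
  index :: nat
  trace :: "('t, 'k, 'd) operation list"

definition initial_state ::
    "('k::finite, 'd::finite) placing_input \<Rightarrow> ('t, 'd) search_structure \<Rightarrow> ('t, 'k, 'd) state" where
  "initial_state A D =
     (let ps = map (param A) (start_params A) in
      \<lparr> params = start_params A,
        tree = ss_build D ps,
        index = 0,
        trace = concat (map (\<lambda>\<xi>. [Eval_Param \<xi>, Elementary Store]) (start_params A))
                @ [Build ps, Elementary Initialize] \<rparr>)"

text \<open>
  One candidate, in the direction \<open>s\<close> from \<open>\<xi>\<close>; \<open>p\<close>, \<open>hi\<close> and \<open>J\<close> are the point, spacing and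
  Jacobian already computed at \<open>\<xi>\<close>.
\<close>

definition candidate_step ::
    "('k::finite, 'd::finite) placing_input \<Rightarrow> ('t, 'd) search_structure \<Rightarrow> real ^ 'k \<Rightarrow> real ^ 'd \<Rightarrow>
     real \<Rightarrow> real ^ 'k ^ 'd \<Rightarrow> real ^ 'k \<Rightarrow> ('t, 'k, 'd) state \<Rightarrow> ('t, 'k, 'd) state" where
  "candidate_step A D \<xi> p hi J s \<sigma> =
     (let \<eta> = \<xi> + (hi / norm (J *v s)) *\<^sub>R s;
          tr = trace \<sigma> @ [Elementary Rotate_Direction, Elementary Form_Candidate, Elementary Domain_Test]
      in if \<eta> \<in> domain_set A then
           (let c = param A \<eta>;
                hhat = norm (c - p);
                q = ss_closest D (tree \<sigma>) c;
                tr' = tr @ [Eval_Param \<eta>, Elementary Compute_Distance, Query (tree \<sigma>) c,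
                            Elementary Compute_Distance, Elementary Compare]
            in if norm (c - q) \<ge> hhat then
                 \<sigma>\<lparr> params := params \<sigma> @ [\<eta>],
                    tree := ss_insert D c (tree \<sigma>),
                    trace := tr' @ [Elementary Append_Param, Insert c (tree \<sigma>)] \<rparr>
               else \<sigma>\<lparr> trace := tr' \<rparr>)
         else \<sigma>\<lparr> trace := tr \<rparr>)"

definition iteration ::
    "('k::finite, 'd::finite) placing_input \<Rightarrow> ('t, 'd) search_structure \<Rightarrow> (nat \<Rightarrow> real ^ 'k ^ 'k) \<Rightarrow>
     ('t, 'k, 'd) state \<Rightarrow> ('t, 'k, 'd) state" where
  "iteration A D rot \<sigma> =
     (let i = index \<sigma>;
          \<xi> = params \<sigma> ! i;
          p = param A \<xi>;
          hi = spacing A p;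
          J = jac A \<xi>;
          \<sigma>0 = \<sigma>\<lparr> trace := trace \<sigma> @ [Elementary Loop_Test, Elementary Fetch, Eval_Param \<xi>,
                    Elementary Eval_Spacing, Eval_Jac \<xi>, Elementary Draw_Rotation] \<rparr>;
          \<sigma>1 = fold (candidate_step A D \<xi> p hi J) (map (\<lambda>u. rot i *v u) (base_dirs A)) \<sigma>0
      in \<sigma>1\<lparr> index := Suc i, trace := trace \<sigma>1 @ [Elementary Increment] \<rparr>)"

text \<open>The value is \<open>None\<close> exactly when the loop does not terminate.\<close>

definition run ::
    "('k::finite, 'd::finite) placing_input \<Rightarrow> ('t, 'd) search_structure \<Rightarrow> (nat \<Rightarrow> real ^ 'k ^ 'k) \<Rightarrow>
     ('t, 'k, 'd) state option" where
  "run A D rot =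
     while_option (\<lambda>\<sigma>. index \<sigma> < length (params \<sigma>)) (iteration A D rot) (initial_state A D)"


text \<open>
  An execution on a machine: the input, the search structure, the outcome \<open>rotation\<close> of the random
  choices (one rotation per iteration), the machine's cost function, and the quantities
  e1 = \<open>param_cost\<close>, e2 = \<open>jac_cost\<close>, P = \<open>build_cost\<close>, Q = \<open>query_cost\<close>, I = \<open>insert_cost\<close>. The cost of
  an operation may depend on the list of operations executed before it, as it does for an array
  that is occasionally reallocated.
\<close>

record ('t, 'k, 'd) execution =
  input :: "('k, 'd) placing_input"
  structure_impl :: "('t, 'd) search_structure"
  rotation :: "nat \<Rightarrow> real ^ 'k ^ 'k"
  cost :: "('t, 'k, 'd) operation list \<Rightarrow> ('t, 'k, 'd) operation \<Rightarrow> real"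
  param_cost :: real
  jac_cost :: real
  build_cost :: "nat \<Rightarrow> real"
  query_cost :: "nat \<Rightarrow> real"
  insert_cost :: "nat \<Rightarrow> real"

definition outcome ::
    "('t, 'k::finite, 'd::finite) execution \<Rightarrow> ('t, 'k, 'd) state option" where
  "outcome E = run (input E) (structure_impl E) (rotation E)"

definition terminates :: "('t, 'k::finite, 'd::finite) execution \<Rightarrow> bool" where
  "terminates E \<longleftrightarrow> outcome E \<noteq> None"

definition final_params :: "('t, 'k::finite, 'd::finite) execution \<Rightarrow> (real ^ 'k) list" where
  "final_params E = params (the (outcome E))"

definition returned_nodes :: "('t, 'k::finite, 'd::finite) execution \<Rightarrow> (real ^ 'd) list" where
  "returned_nodes E = map (param (input E)) (final_params E)"

text \<open>The last failing loop test and the construction of the returned list are included.\<close>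

definition full_trace ::
    "('t, 'k::finite, 'd::finite) execution \<Rightarrow> ('t, 'k, 'd) operation list" where
  "full_trace E =
     trace (the (outcome E)) @ [Elementary Loop_Test]
     @ concat (map (\<lambda>\<xi>. [Eval_Param \<xi>, Elementary Store]) (final_params E))
     @ [Elementary Return]"

definition num_start :: "('t, 'k::finite, 'd::finite) execution \<Rightarrow> nat" where
  "num_start E = length (start_params (input E))"

definition num_candidates :: "('t, 'k::finite, 'd::finite) execution \<Rightarrow> nat" where
  "num_candidates E = length (base_dirs (input E))"

definition num_nodes :: "('t, 'k::finite, 'd::finite) execution \<Rightarrow> nat" where
  "num_nodes E = length (returned_nodes E)"

definition running_time :: "('t, 'k::finite, 'd::finite) execution \<Rightarrow> real" where
  "running_time E =
     (\<Sum>k<length (full_trace E). cost E (take k (full_trace E)) (full_trace E ! k))"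

definition elementary_amortized_constant ::
    "real \<Rightarrow> ('t, 'k::finite, 'd::finite) execution \<Rightarrow> bool" where
  "elementary_amortized_constant \<kappa> E \<longleftrightarrow>
     (let tr = full_trace E; K = {k. k < length tr \<and> is_elementary (tr ! k)} in
      (\<Sum>k\<in>K. cost E (take k tr) (tr ! k)) \<le> \<kappa> * real (card K))"

text \<open>
  The time unit is chosen so that the five cost bounds are at least 1. Without a positive lower
  bound on them, the elementary operations would not be absorbed by the terms of the claim.
\<close>

definition cost_assumptions ::
    "real \<Rightarrow> ('t, 'k::finite, 'd::finite) execution \<Rightarrow> bool" where
  "cost_assumptions \<kappa> E \<longleftrightarrow>
     (\<forall>hist op. 0 \<le> cost E hist op) \<and>
     1 \<le> param_cost E \<and> 1 \<le> jac_cost E \<and>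
     (\<forall>m. 1 \<le> build_cost E m \<and> 1 \<le> query_cost E m \<and> 1 \<le> insert_cost E m) \<and>
     (\<forall>hist. \<forall>\<xi>\<in>domain_set (input E).
        cost E hist (Eval_Param \<xi>) \<le> param_cost E \<and> cost E hist (Eval_Jac \<xi>) \<le> jac_cost E) \<and>
     (\<forall>hist ps. cost E hist (Build ps) \<le> build_cost E (length ps)) \<and>
     (\<forall>hist T c m.
        ss_invar (structure_impl E) T \<and> size (ss_points (structure_impl E) T) \<le> m \<longrightarrow>
        cost E hist (Query T c) \<le> query_cost E m \<and> cost E hist (Insert c T) \<le> insert_cost E m) \<and>
     elementary_amortized_constant \<kappa> E"

text \<open>
  Orthogonal matrices include the rotations. Since \<open>rotation\<close> is arbitrary, whatever holds for all
  admissible executions holds for every outcome of the random choices.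
\<close>

definition admissible :: "real \<Rightarrow> ('t, 'k::finite, 'd::finite) execution \<Rightarrow> bool" where
  "admissible \<kappa> E \<longleftrightarrow>
     valid_input (input E) \<and>
     valid_search_structure (structure_impl E) \<and>
     (\<forall>i. orthogonal_matrix (rotation E i)) \<and>
     terminates E \<and>
     cost_assumptions \<kappa> E"

end

theory Submission
  imports Defs
begin

text \<open>
  Give every operation a fixed price and every elementary operation the price \<open>\<bar>\<kappa>\<bar>\<close>. The search
  structure always stores exactly one point per parameter, and parameters are never removed, so
  every query and insertion meets at most \<open>N\<close> points and costs at most its price. Each of the \<open>N\<close>
  iterations adds a bounded price apart from insertions, of which there are \<open>N - N\<^sub>s\<close> in total. The
  elementary operations are absorbed because the cost bounds are at least \<open>1\<close>.
\<close>

section \<open>Prices of operations and the loop invariant\<close>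

primrec op_price ::
    "real \<Rightarrow> real \<Rightarrow> real \<Rightarrow> real \<Rightarrow> real \<Rightarrow> real \<Rightarrow> ('t, 'k::finite, 'd::finite) operation \<Rightarrow> real" where
  "op_price e1 e2 b q i k (Eval_Param \<xi>) = e1"
| "op_price e1 e2 b q i k (Eval_Jac \<xi>) = e2"
| "op_price e1 e2 b q i k (Build ps) = b"
| "op_price e1 e2 b q i k (Query T c) = q"
| "op_price e1 e2 b q i k (Insert c T) = i"
| "op_price e1 e2 b q i k (Elementary x) = k"

abbreviation trace_price ::
    "real \<Rightarrow> real \<Rightarrow> real \<Rightarrow> real \<Rightarrow> real \<Rightarrow> real \<Rightarrow> ('t, 'k::finite, 'd::finite) operation list \<Rightarrow> real" where
  "trace_price e1 e2 b q i k tr \<equiv> sum_list (map (op_price e1 e2 b q i k) tr)"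

text \<open>These are the side conditions under which \<open>cost_assumptions\<close> bounds the
  cost of an operation by its price, with \<open>m\<close> as the capacity of the structure.
  Elementary operations carry none, since their costs are bounded only in total.\<close>

primrec priced_op ::
    "('k::finite, 'd::finite) placing_input \<Rightarrow> ('t, 'd) search_structure \<Rightarrow> nat \<Rightarrow>
     ('t, 'k, 'd) operation \<Rightarrow> bool" where
  "priced_op A D m (Eval_Param \<xi>) \<longleftrightarrow> \<xi> \<in> domain_set A"
| "priced_op A D m (Eval_Jac \<xi>) \<longleftrightarrow> \<xi> \<in> domain_set A"
| "priced_op A D m (Build ps) \<longleftrightarrow> length ps = length (start_params A)"
| "priced_op A D m (Query T c) \<longleftrightarrow> ss_invar D T \<and> size (ss_points D T) \<le> m"
| "priced_op A D m (Insert c T) \<longleftrightarrow> ss_invar D T \<and> size (ss_points D T) \<le> m"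
| "priced_op A D m (Elementary x) \<longleftrightarrow> True"

lemma priced_op_mono: "priced_op A D m op \<Longrightarrow> m \<le> m' \<Longrightarrow> priced_op A D m' op"
  by (cases op) auto

text \<open>The capacity is the current number of parameters, which only grows. At termination it is
  the number of nodes, and every query and insertion recorded on the way is covered by it.\<close>

definition wf_state ::
    "('k::finite, 'd::finite) placing_input \<Rightarrow> ('t, 'd) search_structure \<Rightarrow> ('t, 'k, 'd) state \<Rightarrow> bool" where
  "wf_state A D \<sigma> \<longleftrightarrow>
     set (params \<sigma>) \<subseteq> domain_set A \<and> length (start_params A) \<le> length (params \<sigma>) \<and>
     ss_invar D (tree \<sigma>) \<and> size (ss_points D (tree \<sigma>)) = length (params \<sigma>) \<and>
     (\<forall>op\<in>set (trace \<sigma>). priced_op A D (length (params \<sigma>)) op)"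

text \<open>
  An accepted candidate pays for its own insertion: subtracting the price of one insertion per
  stored parameter makes the growth independent of the acceptance decisions.
\<close>

definition potential ::
    "real \<Rightarrow> real \<Rightarrow> real \<Rightarrow> real \<Rightarrow> real \<Rightarrow> real \<Rightarrow> ('t, 'k::finite, 'd::finite) state \<Rightarrow> real" where
  "potential e1 e2 b q i k \<sigma> =
     trace_price e1 e2 b q i k (trace \<sigma>) - real (length (params \<sigma>)) * (i + k)"

section \<open>Effect of one candidate and of one iteration\<close>

lemma candidate_step_wf_state:
  assumes D: "valid_search_structure D" and wf: "wf_state A D \<sigma>"
  shows "wf_state A D (candidate_step A D \<xi> p hi J s \<sigma>)"
  \<comment> \<open>Query and insertion are both recorded with the tree before the insertion, which
    holds exactly \<open>length (params \<sigma>)\<close> points. Older entries of the trace survive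
    the growth by \<open>priced_op_mono\<close>.\<close>
  using wf D
  unfolding wf_state_def candidate_step_def valid_search_structure_def
  by (auto simp: Let_def intro: priced_op_mono)

lemma candidate_step_index [simp]: "index (candidate_step A D \<xi> p hi J s \<sigma>) = index \<sigma>"
  by (simp add: candidate_step_def Let_def)

lemma candidate_step_length:
  "length (params \<sigma>) \<le> length (params (candidate_step A D \<xi> p hi J s \<sigma>))"
  by (simp add: candidate_step_def Let_def)

text \<open>A candidate inside the domain takes one evaluation, one query and six elementary
  operations. Acceptance adds \<open>Append_Param\<close> and \<open>Insert\<close>, of price
  \<open>i + k\<close>, exactly what the longer parameter list subtracts.\<close>

lemma candidate_step_potential:
  assumes "0 \<le> e1" "0 \<le> q" "0 \<le> k"
  shows "potential e1 e2 b q i k (candidate_step A D \<xi> p hi J s \<sigma>)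
           \<le> potential e1 e2 b q i k \<sigma> + (e1 + q + 6 * k)"
  using assms by (simp add: candidate_step_def potential_def Let_def algebra_simps)

lemma candidate_fold_wf_state:
  assumes "valid_search_structure D" and "wf_state A D \<sigma>"
  shows "wf_state A D (fold (candidate_step A D \<xi> p hi J) ss \<sigma>)"
  using assms(2) by (induction ss arbitrary: \<sigma>) (auto intro: candidate_step_wf_state assms(1))

lemma candidate_fold_index [simp]: "index (fold (candidate_step A D \<xi> p hi J) ss \<sigma>) = index \<sigma>"
  by (induction ss arbitrary: \<sigma>) auto

lemma candidate_fold_length:
  "length (params \<sigma>) \<le> length (params (fold (candidate_step A D \<xi> p hi J) ss \<sigma>))"
proof (induction ss arbitrary: \<sigma>)
  case (Cons s ss)
  show ?case
    using candidate_step_length[of \<sigma> A D \<xi> p hi J s] Cons[of "candidate_step A D \<xi> p hi J s \<sigma>"]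
    by simp
qed simp

lemma candidate_fold_potential:
  assumes "0 \<le> e1" "0 \<le> q" "0 \<le> k"
  shows "potential e1 e2 b q i k (fold (candidate_step A D \<xi> p hi J) ss \<sigma>)
           \<le> potential e1 e2 b q i k \<sigma> + real (length ss) * (e1 + q + 6 * k)"
proof (induction ss arbitrary: \<sigma>)
  case (Cons s ss)
  show ?case
    using candidate_step_potential[OF assms, of e2 b i A D \<xi> p hi J s \<sigma>]
      Cons[of "candidate_step A D \<xi> p hi J s \<sigma>"]
    by (simp add: algebra_simps)
qed simp

text \<open>The \<open>5 * k\<close> pays for \<open>Loop_Test\<close>, \<open>Fetch\<close>,
  \<open>Eval_Spacing\<close>, \<open>Draw_Rotation\<close> and \<open>Increment\<close>. The index
  stays within the list because no candidate shortens it.\<close>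

lemma iteration_invariant:
  assumes D: "valid_search_structure D" and wf: "wf_state A D \<sigma>"
    and i: "index \<sigma> < length (params \<sigma>)"
    and nonneg: "0 \<le> e1" "0 \<le> q" "0 \<le> k"
  shows "wf_state A D (iteration A D rot \<sigma>)"
    and "index (iteration A D rot \<sigma>) = Suc (index \<sigma>)"
    and "Suc (index \<sigma>) \<le> length (params (iteration A D rot \<sigma>))"
    and "potential e1 e2 b q ins k (iteration A D rot \<sigma>)
           \<le> potential e1 e2 b q ins k \<sigma>
              + (e1 + e2 + 5 * k + real (length (base_dirs A)) * (e1 + q + 6 * k))"
proof -
  define \<xi> where "\<xi> = params \<sigma> ! index \<sigma>"
  define J where "J = jac A \<xi>"
  define p where "p = param A \<xi>"
  define hi where "hi = spacing A p"
  define ss where "ss = map (\<lambda>u. rot (index \<sigma>) *v u) (base_dirs A)"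
  define \<sigma>0 where "\<sigma>0 = \<sigma>\<lparr> trace := trace \<sigma> @ [Elementary Loop_Test, Elementary Fetch, Eval_Param \<xi>,
                    Elementary Eval_Spacing, Eval_Jac \<xi>, Elementary Draw_Rotation] \<rparr>"
  define \<sigma>1 where "\<sigma>1 = fold (candidate_step A D \<xi> p hi J) ss \<sigma>0"
  have it: "iteration A D rot \<sigma> =
      \<sigma>1\<lparr> index := Suc (index \<sigma>), trace := trace \<sigma>1 @ [Elementary Increment] \<rparr>"
    by (simp add: iteration_def Let_def \<xi>_def J_def p_def hi_def ss_def \<sigma>0_def \<sigma>1_def)
  have "\<xi> \<in> domain_set A"
    using wf i by (auto simp: wf_state_def \<xi>_def)
  then have "wf_state A D \<sigma>0"
    using wf by (auto simp: wf_state_def \<sigma>0_def)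
  then have "wf_state A D \<sigma>1"
    unfolding \<sigma>1_def by (rule candidate_fold_wf_state[OF D])
  then show "wf_state A D (iteration A D rot \<sigma>)"
    by (auto simp: it wf_state_def)
  show "index (iteration A D rot \<sigma>) = Suc (index \<sigma>)"
    by (simp add: it)
  have "length (params \<sigma>0) \<le> length (params \<sigma>1)"
    unfolding \<sigma>1_def by (rule candidate_fold_length)
  then show "Suc (index \<sigma>) \<le> length (params (iteration A D rot \<sigma>))"
    using i by (simp add: it \<sigma>0_def)
  have "potential e1 e2 b q ins k \<sigma>1
          \<le> potential e1 e2 b q ins k \<sigma>0 + real (length ss) * (e1 + q + 6 * k)"
    unfolding \<sigma>1_def by (rule candidate_fold_potential[OF nonneg])
  then show "potential e1 e2 b q ins k (iteration A D rot \<sigma>)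
           \<le> potential e1 e2 b q ins k \<sigma>
              + (e1 + e2 + 5 * k + real (length (base_dirs A)) * (e1 + q + 6 * k))"
    by (simp add: it \<sigma>0_def ss_def potential_def)
qed

section \<open>From the initial state to the end of the loop\<close>

lemma trace_price_evaluations:
  "trace_price e1 e2 b q i k (concat (map (\<lambda>\<xi>. [Eval_Param \<xi>, Elementary Store]) xs))
     = real (length xs) * (e1 + k)"
  by (induction xs) (auto simp: algebra_simps)

text \<open>The starting points enter the structure by one \<open>Build\<close>, yet the potential
  subtracts an insertion for each of them: hence the credit \<open>- i\<close>. The price of each
  \<open>Store\<close> cancels against the \<open>k\<close> in the potential.\<close>

lemma initial_state_invariant:
  assumes "valid_search_structure D" "valid_input A"
  shows "wf_state A D (initial_state A D)"
    and "index (initial_state A D) = 0"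
    and "potential e1 e2 b q i k (initial_state A D)
           = real (length (start_params A)) * (e1 - i) + b + k"
  using assms
  by (auto simp: wf_state_def initial_state_def Let_def valid_input_def valid_search_structure_def
      potential_def trace_price_evaluations algebra_simps)

text \<open>The loop body runs once per final parameter. Turning the potential back into a price
  adds \<open>i + k\<close> per parameter, whence \<open>6 * k + i\<close> in place of
  \<open>5 * k\<close>.\<close>

lemma run_final_state:
  assumes D: "valid_search_structure D" and A: "valid_input A"
    and nonneg: "0 \<le> e1" "0 \<le> q" "0 \<le> k"
    and run: "run A D rot = Some \<sigma>"
  shows "wf_state A D \<sigma>"
    and "trace_price e1 e2 b q i k (trace \<sigma>)
           \<le> real (length (start_params A)) * (e1 - i) + b + k
             + real (length (params \<sigma>))
               * (e1 + e2 + 6 * k + i + real (length (base_dirs A)) * (e1 + q + 6 * k))"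
proof -
  let ?step = "e1 + e2 + 5 * k + real (length (base_dirs A)) * (e1 + q + 6 * k)"
  \<comment> \<open>The middle conjunct, combined with the failed loop test at exit, fixes the
    number of iterations as the final number of parameters.\<close>
  let ?I = "\<lambda>\<sigma>. wf_state A D \<sigma> \<and> index \<sigma> \<le> length (params \<sigma>) \<and>
     potential e1 e2 b q i k \<sigma>
       \<le> real (length (start_params A)) * (e1 - i) + b + k + real (index \<sigma>) * ?step"
  have I: "?I \<sigma>"
  proof (rule while_option_rule[OF _ run[unfolded run_def]])
    show "?I (initial_state A D)"
      using initial_state_invariant[OF D A] by simp
    fix \<tau> assume I: "?I \<tau>" and lt: "index \<tau> < length (params \<tau>)"
    have "real (Suc (index \<tau>)) * ?step = real (index \<tau>) * ?step + ?step"
      by (simp add: algebra_simps)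
    then show "?I (iteration A D rot \<tau>)"
      using iteration_invariant(1-3)[OF D conjunct1[OF I] lt nonneg]
        iteration_invariant(4)[OF D conjunct1[OF I] lt nonneg, of e2 b i rot] I
      by simp
  qed
  moreover have "\<not> index \<sigma> < length (params \<sigma>)"
    using while_option_stop[OF run[unfolded run_def]] .
  ultimately have "index \<sigma> = length (params \<sigma>)"
    by simp
  with I show "trace_price e1 e2 b q i k (trace \<sigma>)
           \<le> real (length (start_params A)) * (e1 - i) + b + k
             + real (length (params \<sigma>))
               * (e1 + e2 + 6 * k + i + real (length (base_dirs A)) * (e1 + q + 6 * k))"
    by (simp add: potential_def algebra_simps)
  from I show "wf_state A D \<sigma>"
    by simp
qed

section \<open>Comparison of costs with prices\<close>

lemma running_time_le_trace_price:
  assumes cost: "cost_assumptions \<kappa> E"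
    and priced: "\<And>op. op \<in> set (full_trace E) \<Longrightarrow>
           priced_op (input E) (structure_impl E) m op"
  shows "running_time E \<le> trace_price (param_cost E) (jac_cost E) (build_cost E (num_start E))
           (query_cost E m) (insert_cost E m) \<bar>\<kappa>\<bar> (full_trace E)"
proof -
  define tr where "tr = full_trace E"
  \<comment> \<open>Amortization bounds the elementary costs only as a sum, so the positions are
    split: those in \<open>K\<close> are compared in total, all others one by one.\<close>
  define K where "K = {k. k < length tr \<and> is_elementary (tr ! k)}"
  define pr :: "('a, 'b, 'c) operation \<Rightarrow> real"
    where "pr = op_price (param_cost E) (jac_cost E) (build_cost E (num_start E))
           (query_cost E m) (insert_cost E m) \<bar>\<kappa>\<bar>"
  have K: "K \<subseteq> {..<length tr}"
    by (auto simp: K_def)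
  have "(\<Sum>k\<in>K. cost E (take k tr) (tr ! k)) \<le> \<kappa> * real (card K)"
    using cost by (simp add: cost_assumptions_def elementary_amortized_constant_def K_def tr_def Let_def)
  \<comment> \<open>The sign of \<kappa> is unrestricted, whereas the potential estimates require a
    nonnegative price.\<close>
  also have "\<dots> \<le> \<bar>\<kappa>\<bar> * real (card K)"
    by (intro mult_right_mono) auto
  also have "\<dots> = (\<Sum>k\<in>K. pr (tr ! k))"
  proof -
    have "pr (tr ! k) = \<bar>\<kappa>\<bar>" if "k \<in> K" for k
      using that by (cases "tr ! k") (auto simp: K_def pr_def)
    then show ?thesis by simp
  qed
  finally have elem: "(\<Sum>k\<in>K. cost E (take k tr) (tr ! k)) \<le> (\<Sum>k\<in>K. pr (tr ! k))" .
  have rest: "(\<Sum>k\<in>{..<length tr} - K. cost E (take k tr) (tr ! k))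
      \<le> (\<Sum>k\<in>{..<length tr} - K. pr (tr ! k))"
  proof (rule sum_mono)
    fix k assume k: "k \<in> {..<length tr} - K"
    then have "priced_op (input E) (structure_impl E) m (tr ! k)"
      by (intro priced) (auto simp: tr_def)
    moreover have "\<not> is_elementary (tr ! k)"
      using k by (auto simp: K_def)
    ultimately show "cost E (take k tr) (tr ! k) \<le> pr (tr ! k)"
      using cost
      by (cases "tr ! k") (auto simp: pr_def cost_assumptions_def num_start_def, metis)
  qed
  have "running_time E = (\<Sum>k<length tr. cost E (take k tr) (tr ! k))"
    by (simp add: running_time_def tr_def)
  also have "\<dots> \<le> (\<Sum>k<length tr. pr (tr ! k))"
    using elem rest sum.subset_diff[OF K, of "\<lambda>k. cost E (take k tr) (tr ! k)"]
      sum.subset_diff[OF K, of "\<lambda>k. pr (tr ! k)"] by simp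
  also have "\<dots> = sum_list (map pr tr)"
    by (simp add: sum_list_sum_nth atLeast0LessThan)
  finally show ?thesis
    by (simp add: pr_def tr_def)
qed

section \<open>Explicit bound for every admissible execution\<close>

abbreviation (input) time_bound :: "('t, 'k::finite, 'd::finite) execution \<Rightarrow> real" where
  "time_bound E \<equiv> (let N = real (num_nodes E); n = real (num_candidates E) in
              build_cost E (num_start E) + N * (n + 1) * param_cost E + N * jac_cost E
              + N * n * query_cost E (num_nodes E) + N * insert_cost E (num_nodes E))"

text \<open>The factor depends on \<kappa> alone, so it serves all executions at once. Nonnegativity
  removes the \<open>norm\<close> in the asymptotic claims, and the first conclusion controls the
  build cost.\<close>

lemma running_time_bound:
  assumes "admissible \<kappa> E"
  shows "num_start E \<le> num_nodes E"
    and "0 \<le> running_time E"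
    and "running_time E \<le> (3 + 8 * \<bar>\<kappa>\<bar>) * time_bound E"
proof -
  have A: "valid_input (input E)" and D: "valid_search_structure (structure_impl E)"
    and cost: "cost_assumptions \<kappa> E"
    using assms by (auto simp: admissible_def)
  obtain \<sigma> where \<sigma>: "outcome E = Some \<sigma>"
    using assms by (auto simp: admissible_def terminates_def)
  define N where "N = num_nodes E"
  define n where "n = num_candidates E"
  define s where "s = num_start E"
  define e1 where "e1 = param_cost E"
  define e2 where "e2 = jac_cost E"
  define b where "b = build_cost E s"
  define q where "q = query_cost E N"
  define i where "i = insert_cost E N"
  have ge1: "1 \<le> e1" "1 \<le> e2" "1 \<le> b" "1 \<le> q" "1 \<le> i"
    using cost by (auto simp: cost_assumptions_def e1_def e2_def b_def q_def i_def)
  have N: "N = length (params \<sigma>)"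
    by (simp add: N_def num_nodes_def returned_nodes_def final_params_def \<sigma>)
  have nonneg: "0 \<le> e1" "0 \<le> q" "0 \<le> \<bar>\<kappa>\<bar>"
    using ge1 by auto
  note fin = run_final_state(1)[OF D A nonneg \<sigma>[unfolded outcome_def]]
    run_final_state(2)[OF D A nonneg \<sigma>[unfolded outcome_def], of e2 b i]
  have sN: "s \<le> N"
    using fin(1) by (simp add: wf_state_def s_def num_start_def N)
  then show "num_start E \<le> num_nodes E"
    by (simp add: s_def N_def)
  show "0 \<le> running_time E"
    using cost by (auto simp: running_time_def cost_assumptions_def intro: sum_nonneg)
  have "running_time E \<le> trace_price e1 e2 b q i \<bar>\<kappa>\<bar> (full_trace E)"
    unfolding e1_def e2_def b_def q_def i_def s_def
  proof (rule running_time_le_trace_price[OF cost])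
    fix op assume "op \<in> set (full_trace E)"
    then show "priced_op (input E) (structure_impl E) N op"
      using fin(1) by (auto simp: full_trace_def final_params_def \<sigma> wf_state_def N)
  qed
  \<comment> \<open>The closing \<open>Loop_Test\<close> and \<open>Return\<close> give
    \<open>2 * \<bar>\<kappa>\<bar>\<close>; the returned list takes one more evaluation and one
    \<open>Store\<close> per node.\<close>
  also have "\<dots> = trace_price e1 e2 b q i \<bar>\<kappa>\<bar> (trace \<sigma>) + 2 * \<bar>\<kappa>\<bar> + N * (e1 + \<bar>\<kappa>\<bar>)"
    by (simp add: full_trace_def final_params_def \<sigma> trace_price_evaluations N)
  also have "\<dots> \<le> s * (e1 - i) + b + 3 * \<bar>\<kappa>\<bar>
      + N * (2 * e1 + e2 + 7 * \<bar>\<kappa>\<bar> + i + n * (e1 + q + 6 * \<bar>\<kappa>\<bar>))"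
    using fin(2) by (simp add: s_def num_start_def n_def num_candidates_def N algebra_simps)
  also have "\<dots> \<le> (3 + 8 * \<bar>\<kappa>\<bar>) * (b + N * (real n + 1) * e1 + N * e2 + N * n * q + N * i)"
  proof -
    \<comment> \<open>The insertion credit of the starting points is dropped, and their evaluations
      are charged to the \<open>N\<close> nodes.\<close>
    have "s * (e1 - i) \<le> s * e1"
      using ge1 by (intro mult_left_mono) auto
    also have "\<dots> \<le> N * e1"
      using sN ge1 by (intro mult_right_mono) auto
    finally have 1: "s * (e1 - i) \<le> N * e1" .
    define F where "F = b + real N * e1 + real N * n * e1 + real N * e2 + real N * n * q + real N * i"
    have nonneg: "0 \<le> real N * e1" "0 \<le> real N * e2" "0 \<le> real N * i"
      "0 \<le> real N * n * q" "0 \<le> real N * n * e1"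
      using ge1 by auto
    have "real N * 1 \<le> real N * e1" "real N * n * 1 \<le> real N * n * e1"
      using ge1 by (intro mult_left_mono; simp)+
    \<comment> \<open>Here the lower bound \<open>1\<close> on the costs absorbs the elementary
      operations: \<open>3\<close> is charged to \<open>b\<close>, \<open>7 * N\<close> to
      \<open>N * e1\<close>, and \<open>6 * (N * n)\<close> to \<open>N * n * e1\<close>.\<close>
    then have "3 + 7 * real N + 6 * (real N * n) \<le> 8 * F"
      using nonneg ge1 F_def unfolding mult_1_right by linarith
    then have 2: "\<bar>\<kappa>\<bar> * (3 + 7 * real N + 6 * (real N * n)) \<le> \<bar>\<kappa>\<bar> * (8 * F)"
      by (rule mult_left_mono) simp
    \<comment> \<open>The factor \<open>3\<close> comes from \<open>N * e1\<close>, which arises in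
      the initialization, in the iterations and in the returned list.\<close>
    have 3: "s * (e1 - i) + b + 2 * (real N * e1) + real N * e2 + real N * i
        + real N * n * e1 + real N * n * q \<le> 3 * F"
      using 1 nonneg ge1 F_def by linarith
    have "s * (e1 - i) + b + 3 * \<bar>\<kappa>\<bar>
        + N * (2 * e1 + e2 + 7 * \<bar>\<kappa>\<bar> + i + n * (e1 + q + 6 * \<bar>\<kappa>\<bar>))
      = (s * (e1 - i) + b + 2 * (real N * e1) + real N * e2 + real N * i
          + real N * n * e1 + real N * n * q) + \<bar>\<kappa>\<bar> * (3 + 7 * real N + 6 * (real N * n))"
      by (simp add: algebra_simps)
    also have "\<dots> \<le> 3 * F + \<bar>\<kappa>\<bar> * (8 * F)"
      by (rule add_mono[OF 3 2])
    also have "\<dots> = (3 + 8 * \<bar>\<kappa>\<bar>) * (b + N * (real n + 1) * e1 + N * e2 + N * n * q + N * i)"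
      by (simp add: F_def algebra_simps)
    finally show ?thesis .
  qed
  finally show "running_time E \<le> (3 + 8 * \<bar>\<kappa>\<bar>) * time_bound E"
    by (simp add: Let_def N_def n_def e1_def e2_def b_def q_def i_def s_def)
qed

section \<open>Asymptotics with logarithms\<close>

text \<open>Only finitely many indices lie below the threshold, and from \<open>2\<close> on the
  logarithm is at least \<open>ln 2\<close>, so a multiple of it absorbs their values. The cutoff is
  \<open>2\<close> because \<open>ln 1 = 0\<close>.\<close>

lemma bigo_ln_bound:
  fixes Q :: "nat \<Rightarrow> real"
  assumes "Q \<in> O(\<lambda>m. ln (real m))"
  obtains C where "0 \<le> C" "\<And>m. 2 \<le> m \<Longrightarrow> Q m \<le> C * ln (real m)"
proof -
  obtain c where c: "0 < c" "\<forall>\<^sub>F m in sequentially. norm (Q m) \<le> c * norm (ln (real m))"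
    using assms by (auto elim: landau_o.bigE)
  then obtain m0 where m0: "\<And>m. m \<ge> m0 \<Longrightarrow> \<bar>Q m\<bar> \<le> c * \<bar>ln (real m)\<bar>"
    by (auto simp: eventually_sequentially)
  define B where "B = (\<Sum>m<m0. \<bar>Q m\<bar>)"
  have B: "0 \<le> B" by (simp add: B_def sum_nonneg)
  have ln2: "(0::real) < ln 2" by simp
  show thesis
  proof (rule that[of "c + B / ln 2"])
    show "0 \<le> c + B / ln 2"
      using c B by simp
    fix m :: nat assume m: "2 \<le> m"
    then have ln: "ln 2 \<le> ln (real m)" by simp
    have ln0: "0 \<le> ln (real m)" using ln ln2 by linarith
    have "B \<le> B / ln 2 * ln (real m)"
      using B ln by (simp add: divide_simps mult_left_mono)
    moreover have "\<bar>Q m\<bar> \<le> c * ln (real m) + B"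
    proof (cases "m < m0")
      case True
      then have "\<bar>Q m\<bar> \<le> B"
        unfolding B_def by (intro member_le_sum) auto
      then show ?thesis using c ln0 by (simp add: add_increasing)
    next
      case False
      then show ?thesis using m0[of m] B ln0 by simp
    qed
    ultimately show "Q m \<le> (c + B / ln 2) * ln (real m)"
      by (simp add: algebra_simps)
  qed
qed

text \<open>\<open>P\<close> is not assumed monotone, so the comparison passes through
  \<open>m * ln m\<close>, which is. Separating \<open>s\<close> from \<open>m\<close> lets the
  build cost on few starting points be measured by the number of nodes.\<close>

lemma bigo_n_ln_n_bound:
  fixes P :: "nat \<Rightarrow> real"
  assumes "P \<in> O(\<lambda>m. real m * ln (real m))"
  obtains C where "0 \<le> C" "\<And>s m. s \<le> m \<Longrightarrow> 2 \<le> m \<Longrightarrow> P s \<le> C * (real m * ln (real m))"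
proof -
  obtain c where c: "0 < c" "\<forall>\<^sub>F m in sequentially. norm (P m) \<le> c * norm (real m * ln (real m))"
    using assms by (auto elim: landau_o.bigE)
  then obtain m0 where m0: "\<And>m. m \<ge> m0 \<Longrightarrow> \<bar>P m\<bar> \<le> c * \<bar>real m * ln (real m)\<bar>"
    by (auto simp: eventually_sequentially)
  define B where "B = (\<Sum>m<m0. \<bar>P m\<bar>)"
  have B: "0 \<le> B" by (simp add: B_def sum_nonneg)
  have ln2: "(0::real) < ln 2" by simp
  show thesis
  proof (rule that[of "c + B / ln 2"])
    show "0 \<le> c + B / ln 2"
      using c B by simp
    fix s m :: nat assume s: "s \<le> m" and m: "2 \<le> m"
    have "ln 2 \<le> ln (real m)" using m by simp
    also have "\<dots> \<le> real m * ln (real m)"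
      using m by (simp add: mult_le_cancel_right1)
    finally have ln: "ln 2 \<le> real m * ln (real m)" .
    have ln0: "0 \<le> real m * ln (real m)" using ln ln2 by linarith
    have "B \<le> B / ln 2 * (real m * ln (real m))"
      using mult_left_mono[OF ln B] by (simp add: divide_simps)
    moreover have "\<bar>P s\<bar> \<le> c * (real m * ln (real m)) + B"
    proof (cases "s < m0")
      case True
      then have "\<bar>P s\<bar> \<le> B"
        unfolding B_def by (intro member_le_sum) auto
      then show ?thesis using c ln0 by (simp add: add_increasing)
    next
      case False
      \<comment> \<open>The logarithm is nonnegative and monotone from \<open>1\<close> on; at
        \<open>s = 0\<close> the factor \<open>real s\<close> settles the claim.\<close>
      have "\<bar>real s * ln (real s)\<bar> \<le> real m * ln (real m)"
      proof (cases "s = 0")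
        case True
        then show ?thesis using ln0 by simp
      next
        case False
        then show ?thesis
          using s by (simp add: abs_mult mult_mono)
      qed
      then have "c * \<bar>real s * ln (real s)\<bar> \<le> c * (real m * ln (real m))"
        using c by (intro mult_left_mono) auto
      then show ?thesis using m0[of s] False B by linarith
    qed
    ultimately show "P s \<le> (c + B / ln 2) * (real m * ln (real m))"
      by (simp add: algebra_simps)
  qed
qed

text \<open>Each of the five terms is at most a multiple of \<open>n * N * ln N\<close>: a missing
  factor \<open>n\<close> is supplied by \<open>n \<ge> 1\<close>, a missing logarithm by
  \<open>N \<ge> 2\<close> at the expense of a factor \<open>1 / ln 2\<close>.\<close>

lemma running_time_n_ln_n:
  fixes S :: "('t, 'k::finite, 'd::finite) execution set"
  assumes P: "P \<in> O(\<lambda>m. real m * ln (real m))"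
    and Q: "Q \<in> O(\<lambda>m. ln (real m))" and I: "I \<in> O(\<lambda>m. ln (real m))"
    and S: "\<And>E. E \<in> S \<Longrightarrow> admissible \<kappa> E \<and>
           build_cost E = P \<and> query_cost E = Q \<and> insert_cost E = I \<and>
           param_cost E = e1 \<and> jac_cost E = e2 \<and>
           1 \<le> num_candidates E \<and> 2 \<le> num_nodes E"
  shows "running_time \<in> O[principal S](\<lambda>E. real (num_candidates E) * real (num_nodes E) * ln (real (num_nodes E)))"
proof -
  obtain CP where CP: "0 \<le> CP" "\<And>s m. s \<le> m \<Longrightarrow> 2 \<le> m \<Longrightarrow> P s \<le> CP * (real m * ln (real m))"
    using bigo_n_ln_n_bound[OF P] by blast
  obtain CQ where CQ: "0 \<le> CQ" "\<And>m. 2 \<le> m \<Longrightarrow> Q m \<le> CQ * ln (real m)"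
    using bigo_ln_bound[OF Q] by blast
  obtain CI where CI: "0 \<le> CI" "\<And>m. 2 \<le> m \<Longrightarrow> I m \<le> CI * ln (real m)"
    using bigo_ln_bound[OF I] by blast
  \<comment> \<open>One summand per term of \<open>time_bound\<close>; the \<open>2\<close> comes
    from \<open>n + 1 \<le> 2 * n\<close>.\<close>
  define C where "C = CP + 2 * \<bar>e1\<bar> / ln 2 + \<bar>e2\<bar> / ln 2 + CQ + CI"
  show ?thesis
  proof (rule bigoI[of _ "(3 + 8 * \<bar>\<kappa>\<bar>) * C"], unfold eventually_principal, rule ballI)
    fix E assume E: "E \<in> S"
    define N where "N = real (num_nodes E)"
    define n where "n = real (num_candidates E)"
    define L where "L = ln N"
    note adm = conjunct1[OF S[OF E]]
    note rt = running_time_bound[OF adm]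
    have N: "2 \<le> N" and n: "1 \<le> n"
      using S[OF E] by (auto simp: N_def n_def)
    have L: "ln 2 \<le> L" using N by (simp add: L_def)
    have L0: "0 \<le> L" using N by (simp add: L_def)
    have NL: "0 \<le> N * L" using N L0 by simp
    have Nn: "N * L \<le> n * N * L"
      using mult_right_mono[OF n NL] by (simp add: mult_ac)
    have N1: "N \<le> n * N" using mult_right_mono[OF n, of N] N by simp
    have scale: "a * x \<le> \<bar>a\<bar> / ln 2 * (x * L)" if "0 \<le> x" for a x
    proof -
      have "a * x \<le> \<bar>a\<bar> * x"
        using that by (intro mult_right_mono) auto
      also have "\<dots> = \<bar>a\<bar> * x * ln 2 / ln 2"
        by simp
      also have "\<dots> \<le> \<bar>a\<bar> * x * L / ln 2"
        using that L by (intro divide_right_mono mult_left_mono) auto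
      finally show ?thesis by (simp add: mult.assoc)
    qed
    have p: "P (num_start E) \<le> CP * (n * N * L)"
    proof -
      have "P (num_start E) \<le> CP * (N * L)"
        using CP(2)[OF rt(1)] S[OF E] by (simp add: N_def L_def)
      also have "\<dots> \<le> CP * (n * N * L)"
        using Nn CP(1) by (rule mult_left_mono)
      finally show ?thesis .
    qed
    have x1: "N * (n + 1) * e1 \<le> 2 * \<bar>e1\<bar> / ln 2 * (n * N * L)"
    proof -
      have "N * (n + 1) * e1 \<le> \<bar>e1\<bar> / ln 2 * ((N * (n + 1)) * L)"
        using scale[of "N * (n + 1)" e1] N n by (simp add: mult.commute)
      also have "\<dots> \<le> \<bar>e1\<bar> / ln 2 * (2 * (n * N) * L)"
        using N1 L0 by (intro mult_left_mono mult_right_mono) (auto simp: algebra_simps)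
      finally show ?thesis by (simp add: mult_ac)
    qed
    have x2: "N * e2 \<le> \<bar>e2\<bar> / ln 2 * (n * N * L)"
    proof -
      have "N * e2 \<le> \<bar>e2\<bar> / ln 2 * (N * L)"
        using scale[of N e2] N by (simp add: mult.commute)
      also have "\<dots> \<le> \<bar>e2\<bar> / ln 2 * (n * N * L)"
        using Nn by (intro mult_left_mono) auto
      finally show ?thesis .
    qed
    have q: "N * n * Q (num_nodes E) \<le> CQ * (n * N * L)"
    proof -
      have "N * n * Q (num_nodes E) \<le> N * n * (CQ * L)"
        using CQ(2)[of "num_nodes E"] S[OF E] N n
        by (intro mult_left_mono) (auto simp: N_def L_def)
      then show ?thesis by (simp add: mult_ac)
    qed
    have i: "N * I (num_nodes E) \<le> CI * (n * N * L)"
    proof -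
      have "N * I (num_nodes E) \<le> N * (CI * L)"
        using CI(2)[of "num_nodes E"] S[OF E] N
        by (intro mult_left_mono) (auto simp: N_def L_def)
      also have "\<dots> = CI * (N * L)" by simp
      also have "\<dots> \<le> CI * (n * N * L)"
        using Nn CI(1) by (rule mult_left_mono)
      finally show ?thesis .
    qed
    have "time_bound E = P (num_start E) + N * (n + 1) * e1 + N * e2
        + N * n * Q (num_nodes E) + N * I (num_nodes E)"
      using S[OF E] by (simp add: Let_def N_def n_def)
    then have "time_bound E \<le> C * (n * N * L)"
      using p x1 x2 q i unfolding C_def distrib_right by linarith
    then have "running_time E \<le> (3 + 8 * \<bar>\<kappa>\<bar>) * (C * (n * N * L))"
      using rt(3) mult_left_mono[of "time_bound E" "C * (n * N * L)" "3 + 8 * \<bar>\<kappa>\<bar>"] by linarith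
    moreover have "0 \<le> n * N * L"
      using N n L0 by simp
    ultimately show "norm (running_time E) \<le> (3 + 8 * \<bar>\<kappa>\<bar>) * C *
        norm (real (num_candidates E) * real (num_nodes E) * ln (real (num_nodes E)))"
      using rt(2) by (simp add: N_def n_def L_def mult.assoc)
  qed
qed

text \<open>The filter \<open>principal\<close> makes each O-claim an estimate with one constant
  valid for every execution in the set. In the second part that constant may depend on the fixed
  \<open>P\<close>, \<open>Q\<close>, \<open>I\<close>, \<open>e1\<close> and \<open>e2\<close>; the
  conditions \<open>1 \<le> num_candidates E\<close> and \<open>2 \<le> num_nodes E\<close> keep the
  comparison function positive.\<close>

theorem mainTheorem2:
  fixes \<kappa> :: real
  shows
    "(running_time :: ('t, 'k::finite, 'd::finite) execution \<Rightarrow> real)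
       \<in> O[principal {E. admissible \<kappa> E}](\<lambda>E. let N = real (num_nodes E); n = real (num_candidates E) in
              build_cost E (num_start E) + N * (n + 1) * param_cost E + N * jac_cost E
              + N * n * query_cost E (num_nodes E) + N * insert_cost E (num_nodes E))
     \<and>
     (\<forall>(S :: ('t, 'k, 'd) execution set) P Q I e1 e2.
        P \<in> O(\<lambda>m. real m * ln (real m)) \<and> Q \<in> O(\<lambda>m. ln (real m)) \<and> I \<in> O(\<lambda>m. ln (real m)) \<and>
        (\<forall>E\<in>S. admissible \<kappa> E \<and>
           build_cost E = P \<and> query_cost E = Q \<and> insert_cost E = I \<and>
           param_cost E = e1 \<and> jac_cost E = e2 \<and>
           1 \<le> num_candidates E \<and> 2 \<le> num_nodes E) \<and>
        (\<lambda>E. real (num_start E)) \<in> O[principal S](\<lambda>E. real (num_nodes E))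
        \<longrightarrow>
        running_time \<in> O[principal S](\<lambda>E. real (num_candidates E) * real (num_nodes E) * ln (real (num_nodes E))))"
proof (intro conjI allI impI)
  show "(running_time :: ('t, 'k, 'd) execution \<Rightarrow> real)
       \<in> O[principal {E. admissible \<kappa> E}](\<lambda>E. time_bound E)"
  proof (rule bigoI[of _ "3 + 8 * \<bar>\<kappa>\<bar>"], unfold eventually_principal, rule ballI)
    fix E :: "('t, 'k, 'd) execution" assume "E \<in> {E. admissible \<kappa> E}"
    then have "admissible \<kappa> E" by simp
    note rt = running_time_bound[OF this]
    have "(3 + 8 * \<bar>\<kappa>\<bar>) * time_bound E \<le> (3 + 8 * \<bar>\<kappa>\<bar>) * norm (time_bound E)"
      by (intro mult_left_mono) auto
    then show "norm (running_time E) \<le> (3 + 8 * \<bar>\<kappa>\<bar>) * norm (time_bound E)"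
      using rt(2,3) by simp
  qed
next
  fix S :: "('t, 'k, 'd) execution set" and P Q I e1 e2
  assume "P \<in> O(\<lambda>m. real m * ln (real m)) \<and> Q \<in> O(\<lambda>m. ln (real m)) \<and> I \<in> O(\<lambda>m. ln (real m)) \<and>
        (\<forall>E\<in>S. admissible \<kappa> E \<and>
           build_cost E = P \<and> query_cost E = Q \<and> insert_cost E = I \<and>
           param_cost E = e1 \<and> jac_cost E = e2 \<and>
           1 \<le> num_candidates E \<and> 2 \<le> num_nodes E) \<and>
        (\<lambda>E. real (num_start E)) \<in> O[principal S](\<lambda>E. real (num_nodes E))"
  then show "running_time
      \<in> O[principal S](\<lambda>E. real (num_candidates E) * real (num_nodes E) * ln (real (num_nodes E)))"
    by (elim conjE, intro running_time_n_ln_n[of P Q I S \<kappa> e1 e2]) blast+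
qed

end
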